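(* Let $0\le n\le N-1$ and let $u^n$ and $u^{n+1}$ be the (possibly rank-deficient) discrete DLR solutions at times $t_n$, $t_{n+1}$ produced by the scheme described in the context. Then $$\Big\langle \frac{u^{n+1}-u^n}{\triangle t},v_h\Big\rangle_{H,\hat\rho}+\big(\mathcal L(u^n,u^{n+1}),v_h\big)_{V'V,\hat\rho}=\langle f^{n,n+1},v_h\rangle_{H,\hat\rho}$$ for all $v_h=\bar v_h+v_h^*$ with $\bar v_h\in V_h$ and $v_h^*\in\mathcal T_{\tilde U^{n+1}(Y^n)^{\intercal}}$.
   Context: Setting. $V,H$ are separable real Hilbert spaces forming a Gelfand triple $V\subset H\subset V'$ ($V$ dense and continuously embedded in $H$); $(\cdot,\cdot)_{V'V}$ is the duality pairing, extending $\langle\cdot,\cdot\rangle_H$. $\hat\Gamma=\{\omega_1,\dots,\omega_{\hat N}\}$ is a finite set of points with weights $\lambda_k>0$, $\sum_k\lambda_k=1$, and $\hat\rho=\sum_k\lambda_k\delta_{\omega_k}$. $L^2_{\hat\rho}$ is the space of real functions on $\hat\Gamma$ with $\langle v,w\rangle_{L^2_{\hat\rho}}=\sum_k\lambda_kv(\omega_k)w(\omega_k)$; $\mathbb E_{\hat\rho}[v]=\sum_k\lambda_kv(\omega_k)$ (also for vector-valued $v$); $L^2_{\hat\rho,0}=\{v\in L^2_{\hat\rho}:\mathbb E_{\hat\rho}[v]=0\}$; $v^*:=v-\mathbb E_{\hat\rho}[v]$. For functions on $\hat\Gamma$ with values in $H$ put $\langle v,w\rangle_{H,\hat\rho}=\sum_k\lambda_k\langle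 v(\omega_k),w(\omega_k)\rangle_H$, and for $\mathcal K:\hat\Gamma\to V'$, $v:\hat\Gamma\to V$ put $(\mathcal K,v)_{V'V,\hat\rho}=\sum_k\lambda_k(\mathcal K(\omega_k),v(\omega_k))_{V'V}$. $V_h\subset V$ is a finite-dimensional subspace with $\dim V_h>R$, $R<\hat N$; $V_h\otimes L^2_{\hat\rho}$ is identified with the functions $\hat\Gamma\to V_h$. $\triangle t=T/N$, $t_n=n\triangle t$. The random linear operator $L(\omega):V\to V'$, $\omega\in\hat\Gamma$, is uniformly bounded and coercive, $\mathcal L(u)(\omega)=L(\omega)u(\omega)$. $\mathcal L(u^n,u^{n+1}):\hat\Gamma\to V'$ and $f^{n,n+1}:\hat\Gamma\to H$ stand for an unspecified time integration of $\mathcal L(u(t))$ and of the right-hand side $f(t)$ over $[t_n,t_{n+1}]$ (for example $\mathcal L(u^n)$ or $\mathcal L(u^{n+1})$). Scheme (one step, from $u^n$ to $u^{n+1}$). Given $u^n=\bar u^n+\sum_{j=1}^RU^n_jY^n_j$ with $\bar u^n,U^n_j\in V_h$, $Y^n_j\in L^2_{\hat\rho}$, $\langle Y^n_i,Y^n_j\rangle_{L^2_{\hat\rho}}=\delta_{ij}$, $\mathbb E_{\hat\rho}[Y^n_j]=0$ (the $U^n_j$ need not be linearly independent); write $U=(U_1,\dots,U_R)$, $Y=(Y_1,\dots,Y_R)$ (rows), $UY^{\intercal}=\sum_jU_jY_j$, and $G:=\mathcal L(u^n,u^{n+1})-f^{n,n+1}$. 1. $\bar u^{n+1}\in V_h$: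 $\langle\frac{\bar u^{n+1}-\bar u^n}{\triangle t},v_h\rangle_H+(\mathbb E_{\hat\rho}[G],v_h)_{V'V}=0$ for all $v_h\in V_h$. 2. $\tilde U^{n+1}_j\in V_h$: $\langle\frac{\tilde U^{n+1}_j-U^n_j}{\triangle t},v_h\rangle_H+(\mathbb E_{\hat\rho}[G\,Y^n_j],v_h)_{V'V}=0$ for all $v_h\in V_h$, $j=1,\dots,R$. 3. $\tilde Y^{n+1}\in(L^2_{\hat\rho})^R$: $\frac{\tilde Y^{n+1}-Y^n}{\triangle t}\tilde M^{n+1}+\mathcal P^\perp_{\hat\rho,\mathcal Y^n}\big[(G^*,\tilde U^{n+1})_{V'V}\big]=0$, where $\tilde M^{n+1}_{ij}=\langle\tilde U^{n+1}_i,\tilde U^{n+1}_j\rangle_H$, $(G^*,\tilde U^{n+1})_{V'V}$ is the row $((G^*,\tilde U^{n+1}_j)_{V'V})_j$ of elements of $L^2_{\hat\rho}$, and $\mathcal P^\perp_{\hat\rho,\mathcal Y^n}$ is the $L^2_{\hat\rho}$-orthogonal projection onto the orthogonal complement of $\mathcal Y^n=\mathrm{span}\{Y^n_1,\dots,Y^n_R\}$. If $\tilde M^{n+1}$ is singular, $\tilde Y^{n+1}$ is taken to be a solution of this equation minimizing $\|\tilde Y^{n+1}-Y^n\|_{L^2_{\hat\rho}}$ (norm on $(L^2_{\hat\rho})^R$, i.e. $(\sum_j\|\cdot_j\|^2_{L^2_{\hat\rho}})^{1/2}$). 4. Reorthonormalize: $(U^{n+1},Y^{n+1})$ with $\sum_jY^{n+1}_jU^{n+1}_j=\sum_j\tilde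 Y^{n+1}_j\tilde U^{n+1}_j$ and $\langle Y^{n+1}_i,Y^{n+1}_j\rangle_{L^2_{\hat\rho}}=\delta_{ij}$ (and zero-mean $Y^{n+1}_j$). 5. $u^{n+1}=\bar u^{n+1}+\sum_jU^{n+1}_jY^{n+1}_j$. A solution of the scheme is assumed to exist. Space $\mathcal T_{UY^{\intercal}}$. For $U\in(V_h)^R$ (not necessarily linearly independent) and $Y\in(L^2_{\hat\rho,0})^R$, $$\mathcal T_{UY^{\intercal}}=\Big\{\sum_{i=1}^R(U_i\,\delta Y_i+\delta U_i\,Y_i):\ \delta U_i\in V_h,\ \delta Y_i\in L^2_{\hat\rho,0},\ \langle\delta Y_i,Y_j\rangle_{L^2_{\hat\rho}}=0\ \forall i,j=1,\dots,R\Big\}.$$ *)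

theory Defs
  imports "HOL-Analysis.Analysis"
begin

text \<open>
  Separable real Hilbert spaces are types of sort \<open>{real_inner, polish_space}\<close>, and \<open>V'\<close> is
  \<open>'v \<Rightarrow>\<^sub>L real\<close>. The inclusion of \<open>V\<close> in \<open>H\<close> is a map \<open>\<iota>\<close>, since the two spaces carry different
  norms. The finite set of points is a finite type \<open>'w\<close>, so that functions on it are all functions
  on \<open>'w\<close>; the index set \<open>{1..R}\<close> is a finite type \<open>'r\<close>, so that \<open>R = CARD('r)\<close>.
\<close>

definition gelfand_triple ::
  "('v::{real_inner,polish_space} \<Rightarrow>\<^sub>L 'h::{real_inner,polish_space}) \<Rightarrow> bool" where
  "gelfand_triple \<iota> \<longleftrightarrow> inj (blinfun_apply \<iota>) \<and> closure (range (blinfun_apply \<iota>)) = UNIV"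

text \<open>The embedding of \<open>H\<close> in \<open>V'\<close>: \<open>h\<close> acts on \<open>v\<close> by the \<open>H\<close>-inner product of \<open>h\<close> and \<open>v\<close>.\<close>

definition to_dual ::
  "('v::real_inner \<Rightarrow>\<^sub>L 'h::real_inner) \<Rightarrow> 'h \<Rightarrow> ('v \<Rightarrow>\<^sub>L real)" where
  "to_dual \<iota> h = blinfun_inner_right h o\<^sub>L \<iota>"

definition discrete_prob :: "('w::finite \<Rightarrow> real) \<Rightarrow> bool" where
  "discrete_prob lam \<longleftrightarrow> (\<forall>w. lam w > 0) \<and> (\<Sum>w\<in>UNIV. lam w) = 1"

definition expect :: "('w::finite \<Rightarrow> real) \<Rightarrow> ('w \<Rightarrow> 'a::real_vector) \<Rightarrow> 'a" where
  "expect lam v = (\<Sum>w\<in>UNIV. lam w *\<^sub>R v w)"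

definition centred ::
  "('w::finite \<Rightarrow> real) \<Rightarrow> ('w \<Rightarrow> 'a::real_vector) \<Rightarrow> 'w \<Rightarrow> 'a" where
  "centred lam v = (\<lambda>w. v w - expect lam v)"

definition rho_inner ::
  "('w::finite \<Rightarrow> real) \<Rightarrow> ('w \<Rightarrow> 'h::real_inner) \<Rightarrow> ('w \<Rightarrow> 'h) \<Rightarrow> real" where
  "rho_inner lam v z = (\<Sum>w\<in>UNIV. lam w * (v w \<bullet> z w))"

text \<open>The inner product of \<open>L\<^sup>2\<close> is the case \<open>H = \<real>\<close>.\<close>

abbreviation L2_inner ::
  "('w::finite \<Rightarrow> real) \<Rightarrow> ('w \<Rightarrow> real) \<Rightarrow> ('w \<Rightarrow> real) \<Rightarrow> real" where
  "L2_inner \<equiv> rho_inner"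

definition rho_pairing ::
  "('w::finite \<Rightarrow> real) \<Rightarrow> ('w \<Rightarrow> ('v::real_normed_vector \<Rightarrow>\<^sub>L real)) \<Rightarrow> ('w \<Rightarrow> 'v) \<Rightarrow> real" where
  "rho_pairing lam K v = (\<Sum>w\<in>UNIV. lam w * blinfun_apply (K w) (v w))"

definition L2_0 :: "('w::finite \<Rightarrow> real) \<Rightarrow> ('w \<Rightarrow> real) set" where
  "L2_0 lam = {y. expect lam y = 0}"

definition L2_orthonormal :: "('w::finite \<Rightarrow> real) \<Rightarrow> ('r \<Rightarrow> 'w \<Rightarrow> real) \<Rightarrow> bool" where
  "L2_orthonormal lam Y \<longleftrightarrow> (\<forall>i j. L2_inner lam (Y i) (Y j) = (if i = j then 1 else 0))"

text \<open>The linear span of a finite family of functions (function types are not in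
  \<open>real_vector\<close>, so \<open>span\<close> does not apply).\<close>

definition L2_span :: "('r::finite \<Rightarrow> 'w \<Rightarrow> real) \<Rightarrow> ('w \<Rightarrow> real) set" where
  "L2_span Y = {\<lambda>w. \<Sum>j\<in>UNIV. c j * Y j w |c. True}"

definition L2_orth_compl ::
  "('w::finite \<Rightarrow> real) \<Rightarrow> ('w \<Rightarrow> real) set \<Rightarrow> ('w \<Rightarrow> real) set" where
  "L2_orth_compl lam S = {y. \<forall>z\<in>S. L2_inner lam y z = 0}"

text \<open>The orthogonal projection onto a linear subspace \<open>W\<close>; for positive weights the point exists
  and is unique because the space is finite-dimensional.\<close>

definition L2_proj ::
  "('w::finite \<Rightarrow> real) \<Rightarrow> ('w \<Rightarrow> real) set \<Rightarrow> ('w \<Rightarrow> real) \<Rightarrow> ('w \<Rightarrow> real)" where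
  "L2_proj lam W y =
     (THE p. p \<in> W \<and> (\<forall>z\<in>W. L2_inner lam (\<lambda>w. y w - p w) z = 0))"

definition L2_fam_norm ::
  "('w::finite \<Rightarrow> real) \<Rightarrow> ('r::finite \<Rightarrow> 'w \<Rightarrow> real) \<Rightarrow> real" where
  "L2_fam_norm lam Z = sqrt (\<Sum>j\<in>UNIV. L2_inner lam (Z j) (Z j))"

definition bounded_coercive ::
  "('w \<Rightarrow> ('v::real_normed_vector \<Rightarrow>\<^sub>L ('v \<Rightarrow>\<^sub>L real))) \<Rightarrow> bool" where
  "bounded_coercive L \<longleftrightarrow>
     (\<exists>C. \<forall>w. norm (L w) \<le> C) \<and>
     (\<exists>c>0. \<forall>w v. blinfun_apply (blinfun_apply (L w) v) v \<ge> c * (norm v)\<^sup>2)"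

definition random_op ::
  "('w \<Rightarrow> ('v::real_normed_vector \<Rightarrow>\<^sub>L ('v \<Rightarrow>\<^sub>L real))) \<Rightarrow> ('w \<Rightarrow> 'v) \<Rightarrow> 'w \<Rightarrow> ('v \<Rightarrow>\<^sub>L real)" where
  "random_op L u = (\<lambda>w. blinfun_apply (L w) (u w))"

definition dlr_state ::
  "'v set \<Rightarrow> ('w::finite \<Rightarrow> real) \<Rightarrow> 'v::real_vector \<Rightarrow> ('r::finite \<Rightarrow> 'v) \<Rightarrow>
   ('r \<Rightarrow> 'w \<Rightarrow> real) \<Rightarrow> ('w \<Rightarrow> 'v) \<Rightarrow> bool" where
  "dlr_state Vh lam ub U Y u \<longleftrightarrow>
     ub \<in> Vh \<and> (\<forall>j. U j \<in> Vh) \<and> L2_orthonormal lam Y \<and> (\<forall>j. Y j \<in> L2_0 lam) \<and>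
     u = (\<lambda>w. ub + (\<Sum>j\<in>UNIV. Y j w *\<^sub>R U j))"

definition gram ::
  "('v::real_inner \<Rightarrow>\<^sub>L 'h::real_inner) \<Rightarrow> ('r::finite \<Rightarrow> 'v) \<Rightarrow> real^'r^'r" where
  "gram \<iota> U = (\<chi> i j. blinfun_apply \<iota> (U i) \<bullet> blinfun_apply \<iota> (U j))"

text \<open>The equation for the new stochastic modes \<open>Z\<close>, componentwise in the row index \<open>j\<close>.\<close>

definition stoch_eq ::
  "('v::real_inner \<Rightarrow>\<^sub>L 'h::real_inner) \<Rightarrow> ('w::finite \<Rightarrow> real) \<Rightarrow> real \<Rightarrow>
   ('w \<Rightarrow> ('v \<Rightarrow>\<^sub>L real)) \<Rightarrow> ('r::finite \<Rightarrow> 'w \<Rightarrow> real) \<Rightarrow> ('r \<Rightarrow> 'v) \<Rightarrow>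
   ('r \<Rightarrow> 'w \<Rightarrow> real) \<Rightarrow> bool" where
  "stoch_eq \<iota> lam dt G Y Ut Z \<longleftrightarrow>
     (\<forall>j w. (\<Sum>i\<in>UNIV. (Z i w - Y i w) / dt * gram \<iota> Ut $ i $ j)
        + L2_proj lam (L2_orth_compl lam (L2_span Y))
            (\<lambda>w'. blinfun_apply (centred lam G w') (Ut j)) w = 0)"

text \<open>One step from \<open>(ub, U, Y)\<close> to \<open>(ub', U', Y')\<close> and \<open>u'\<close>, with intermediate modes
  \<open>Ut\<close>, \<open>Yt\<close>. The argument \<open>K\<close> is the time-integrated operator term, which may depend on \<open>u'\<close>.\<close>

definition dlr_step ::
  "('v::real_inner \<Rightarrow>\<^sub>L 'h::real_inner) \<Rightarrow> 'v set \<Rightarrow> ('w::finite \<Rightarrow> real) \<Rightarrow> real \<Rightarrow>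
   ('w \<Rightarrow> ('v \<Rightarrow>\<^sub>L real)) \<Rightarrow> ('w \<Rightarrow> 'h) \<Rightarrow>
   'v \<Rightarrow> ('r::finite \<Rightarrow> 'v) \<Rightarrow> ('r \<Rightarrow> 'w \<Rightarrow> real) \<Rightarrow>
   ('r \<Rightarrow> 'v) \<Rightarrow> ('r \<Rightarrow> 'w \<Rightarrow> real) \<Rightarrow>
   'v \<Rightarrow> ('r \<Rightarrow> 'v) \<Rightarrow> ('r \<Rightarrow> 'w \<Rightarrow> real) \<Rightarrow> ('w \<Rightarrow> 'v) \<Rightarrow> bool" where
  "dlr_step \<iota> Vh lam dt K f ub U Y Ut Yt ub' U' Y' u' \<longleftrightarrow>
     (let G = (\<lambda>w. K w - to_dual \<iota> (f w)) in
      (\<forall>vh\<in>Vh. blinfun_apply \<iota> ((ub' - ub) /\<^sub>R dt) \<bullet> blinfun_apply \<iota> vh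
          + blinfun_apply (expect lam G) vh = 0) \<and>
      (\<forall>j. Ut j \<in> Vh \<and>
        (\<forall>vh\<in>Vh. blinfun_apply \<iota> ((Ut j - U j) /\<^sub>R dt) \<bullet> blinfun_apply \<iota> vh
          + blinfun_apply (expect lam (\<lambda>w. Y j w *\<^sub>R G w)) vh = 0)) \<and>
      stoch_eq \<iota> lam dt G Y Ut Yt \<and>
      (\<not> invertible (gram \<iota> Ut) \<longrightarrow>
        (\<forall>Z. stoch_eq \<iota> lam dt G Y Ut Z \<longrightarrow>
          L2_fam_norm lam (\<lambda>j w. Yt j w - Y j w) \<le> L2_fam_norm lam (\<lambda>j w. Z j w - Y j w))) \<and>
      (\<forall>w. (\<Sum>j\<in>UNIV. Y' j w *\<^sub>R U' j) = (\<Sum>j\<in>UNIV. Yt j w *\<^sub>R Ut j)) \<and>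
      dlr_state Vh lam ub' U' Y' u')"

definition tangent_space ::
  "'v set \<Rightarrow> ('w::finite \<Rightarrow> real) \<Rightarrow> ('r::finite \<Rightarrow> 'v::real_vector) \<Rightarrow> ('r \<Rightarrow> 'w \<Rightarrow> real) \<Rightarrow>
   ('w \<Rightarrow> 'v) set" where
  "tangent_space Vh lam U Y =
     {\<lambda>w. \<Sum>i\<in>UNIV. dY i w *\<^sub>R U i + Y i w *\<^sub>R dU i |dU dY.
        (\<forall>i. dU i \<in> Vh) \<and> (\<forall>i. dY i \<in> L2_0 lam) \<and> (\<forall>i j. L2_inner lam (dY i) (Y j) = 0)}"

end

theory Submission
  imports Defs
begin

text \<open>
  Tensor test functions \<open>y x\<close> with scalar \<open>y\<close> and \<open>x \<in> V\<^sub>h\<close> suffice. The increment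
  is the mean increment plus \<open>(Yt - Y) Ut + Y (Ut - U)\<close>. Testing with \<open>Ut\<^sub>i \<delta>Y\<close> leaves the
  stochastic equation, because the projection is self-adjoint and fixes \<open>\<delta>Y\<close>; testing with
  \<open>Y\<^sub>i \<delta>U\<close> leaves the equation for \<open>Ut\<^sub>i\<close>, provided that
  \<open>\<Sum>\<^sub>k \<langle>Yt\<^sub>k - Y\<^sub>k, Y\<^sub>i\<rangle> Ut\<^sub>k\<close> vanishes. The stochastic equation puts its
  coefficient vector \<open>a\<close> in the kernel of the Gram matrix \<open>M\<close> of \<open>Ut\<close>, and \<open>a\<^sup>T M a\<close> is the
  squared norm of this sum, so singular \<open>M\<close> does no harm.
\<close>

section \<open>The weighted inner product and the orthogonal projection\<close>

lemma rho_inner_commute: "rho_inner lam v z = rho_inner lam z v"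
  by (simp add: rho_inner_def inner_commute)

lemma rho_inner_diff_left:
  "rho_inner lam (\<lambda>w. v w - v' w) z = rho_inner lam v z - rho_inner lam v' z"
  by (simp add: rho_inner_def inner_diff_left right_diff_distrib sum_subtractf)

lemma L2_inner_sum_left:
  "L2_inner lam (\<lambda>w. \<Sum>i\<in>A. v i w * c i) z = (\<Sum>i\<in>A. L2_inner lam (v i) z * c i)"
proof -
  have "L2_inner lam (\<lambda>w. \<Sum>i\<in>A. v i w * c i) z
      = (\<Sum>w\<in>UNIV. \<Sum>i\<in>A. lam w * (v i w * z w) * c i)"
    unfolding rho_inner_def inner_real_def
    by (intro sum.cong refl) (simp add: sum_distrib_left sum_distrib_right mult_ac)
  also have "\<dots> = (\<Sum>i\<in>A. \<Sum>w\<in>UNIV. lam w * (v i w * z w) * c i)"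
    by (rule sum.swap)
  finally show ?thesis
    by (simp add: rho_inner_def sum_distrib_right)
qed

text \<open>Strictly positive weights make the form definite, so the function vanishes at every
  point.\<close>

lemma L2_inner_self_eq_0:
  assumes "discrete_prob lam" "L2_inner lam y y = 0"
  shows "y w = 0"
proof -
  have pos: "lam w > 0" for w
    using assms(1) by (simp add: discrete_prob_def)
  have "\<forall>w\<in>UNIV. lam w * (y w * y w) = 0"
    using assms(2) unfolding rho_inner_def inner_real_def
    by (subst (asm) sum_nonneg_eq_0_iff) (auto intro: mult_nonneg_nonneg less_imp_le[OF pos])
  then show ?thesis
    using pos[of w] by (metis UNIV_I less_irrefl mult_eq_0_iff)
qed

lemma L2_orth_compl_span_iff:
  "y \<in> L2_orth_compl lam (L2_span Y) \<longleftrightarrow> (\<forall>j. L2_inner lam y (Y j) = 0)"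
proof
  assume y: "y \<in> L2_orth_compl lam (L2_span Y)"
  show "\<forall>j. L2_inner lam y (Y j) = 0"
  proof
    fix j
    have "(\<lambda>w. \<Sum>i\<in>UNIV. (if i = j then 1 else 0) * Y i w) \<in> L2_span Y"
      unfolding L2_span_def by (rule CollectI, rule exI) simp
    moreover have "(\<lambda>w. \<Sum>i\<in>UNIV. (if i = j then 1 else 0) * Y i w) = Y j"
      by (simp add: if_distrib[where f = "\<lambda>c. c * _"] cong: if_cong)
    ultimately show "L2_inner lam y (Y j) = 0"
      using y by (simp add: L2_orth_compl_def)
  qed
next
  assume y: "\<forall>j. L2_inner lam y (Y j) = 0"
  have "L2_inner lam (\<lambda>w. \<Sum>j\<in>UNIV. c j * Y j w) y = 0" for c
    using L2_inner_sum_left[of lam Y c UNIV y] y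
    by (simp add: rho_inner_commute[of lam "Y _"] mult.commute[of "c _"])
  then show "y \<in> L2_orth_compl lam (L2_span Y)"
    by (auto simp: L2_orth_compl_def L2_span_def rho_inner_commute[of lam y])
qed

text \<open>Removing the Fourier part along the orthonormal \<open>Y\<close> gives a point with the
  property that defines the projection. It is the only one because the difference of two such points
  lies in the subspace and is orthogonal to it.\<close>

lemma L2_proj_orth_compl_span:
  assumes lam: "discrete_prob lam" and Y: "L2_orthonormal lam Y"
  shows "L2_proj lam (L2_orth_compl lam (L2_span Y)) y = (\<lambda>w. y w - (\<Sum>j\<in>UNIV. Y j w * L2_inner lam y (Y j)))"
    (is "L2_proj lam ?W y = ?p")
  unfolding L2_proj_def
proof (rule the_equality)
  have pW: "?p \<in> ?W"
    using Y by (simp add: L2_orth_compl_span_iff rho_inner_diff_left L2_inner_sum_left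
        L2_orthonormal_def if_distrib[where f = "\<lambda>c. c * _"] cong: if_cong)
  have porth: "L2_inner lam (\<lambda>w. y w - ?p w) z = 0" if "z \<in> ?W" for z
    using that
    by (simp add: L2_orth_compl_span_iff L2_inner_sum_left rho_inner_commute[of lam "Y _"])
  from pW porth show "?p \<in> ?W \<and> (\<forall>z\<in>?W. L2_inner lam (\<lambda>w. y w - ?p w) z = 0)"
    by blast
  fix q assume q: "q \<in> ?W \<and> (\<forall>z\<in>?W. L2_inner lam (\<lambda>w. y w - q w) z = 0)"
  let ?d = "\<lambda>w. q w - ?p w"
  have dW: "?d \<in> ?W"
    using q pW unfolding L2_orth_compl_span_iff
    by (subst rho_inner_diff_left) simp
  \<comment> \<open>Both residuals are orthogonal to the subspace containing \<open>?d\<close>, so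
    \<open>?d\<close> is orthogonal to itself.\<close>
  have "?d = (\<lambda>w. (y w - ?p w) - (y w - q w))"
    by auto
  then have "L2_inner lam ?d ?d
      = L2_inner lam (\<lambda>w. (y w - ?p w) - (y w - q w)) ?d"
    by simp
  also have "\<dots> = L2_inner lam (\<lambda>w. y w - ?p w) ?d - L2_inner lam (\<lambda>w. y w - q w) ?d"
    by (rule rho_inner_diff_left)
  also have "\<dots> = 0"
    using q porth[OF dW] dW by simp
  finally show "q = ?p"
    using L2_inner_self_eq_0[OF lam] by fastforce
qed

lemma
  assumes "discrete_prob lam" "L2_orthonormal lam Y"
  shows L2_proj_orthogonal:
      "L2_inner lam (L2_proj lam (L2_orth_compl lam (L2_span Y)) y) (Y i) = 0"
    and L2_inner_proj:
      "(\<And>j. L2_inner lam z (Y j) = 0) \<Longrightarrow>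
       L2_inner lam (L2_proj lam (L2_orth_compl lam (L2_span Y)) y) z = L2_inner lam y z"
  using assms(2)
  by (simp_all add: L2_proj_orth_compl_span[OF assms] rho_inner_diff_left L2_inner_sum_left
      L2_orthonormal_def rho_inner_commute[of lam "Y _" z]
      if_distrib[where f = "\<lambda>c. c * _"] cong: if_cong)

section \<open>Tensor test functions, expectations and centring\<close>

lemma rho_inner_tensor:
  "rho_inner lam D (\<lambda>w. y w *\<^sub>R x) = expect lam (\<lambda>w. y w *\<^sub>R D w) \<bullet> x"
  by (simp add: rho_inner_def expect_def inner_sum_left mult_ac)

lemma rho_pairing_tensor:
  "rho_pairing lam G (\<lambda>w. y w *\<^sub>R x) = blinfun_apply (expect lam (\<lambda>w. y w *\<^sub>R G w)) x"
  by (simp add: rho_pairing_def expect_def blinfun.sum_left blinfun.scaleR_left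
      blinfun.scaleR_right mult_ac)

lemma expect_add: "expect lam (\<lambda>w. v w + v' w) = expect lam v + expect lam v'"
  by (simp add: expect_def scaleR_add_right sum.distrib)

lemma expect_scaleR_const: "expect lam (\<lambda>w. y w *\<^sub>R x) = expect lam y *\<^sub>R x"
  by (simp add: expect_def scaleR_sum_left)

lemma expect_const: "discrete_prob lam \<Longrightarrow> expect lam (\<lambda>w. x) = x"
  by (simp add: expect_def discrete_prob_def flip: scaleR_sum_left)

lemma expect_sum: "expect lam (\<lambda>w. \<Sum>j\<in>A. v j w) = (\<Sum>j\<in>A. expect lam (v j))"
  unfolding expect_def scaleR_sum_right by (rule sum.swap)

lemma expect_mult: "expect lam (\<lambda>w. y w * z w) = L2_inner lam z y"
  by (simp add: expect_def rho_inner_def mult_ac)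

text \<open>The mean removed by centring is constant in \<open>w\<close>, and a constant pairs to
  zero with a mean-free \<open>z\<close>.\<close>

lemma rho_inner_centred:
  assumes "z \<in> L2_0 lam"
  shows "L2_inner lam (\<lambda>w. blinfun_apply (centred lam G w) x) z
    = blinfun_apply (expect lam (\<lambda>w. z w *\<^sub>R G w)) x"
proof -
  let ?e = "blinfun_apply (expect lam G) x"
  have "L2_inner lam (\<lambda>w. blinfun_apply (centred lam G w) x) z
      = L2_inner lam (\<lambda>w. blinfun_apply (G w) x) z - L2_inner lam (\<lambda>w. ?e) z"
    by (simp add: centred_def blinfun.diff_left rho_inner_diff_left)
  also have "L2_inner lam (\<lambda>w. ?e) z = expect lam z * ?e"
    unfolding rho_inner_def expect_def[of lam z] sum_distrib_right by (simp add: mult_ac)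
  also have "\<dots> = 0"
    using assms by (simp add: L2_0_def)
  finally show ?thesis
    by (simp add: rho_inner_def expect_def blinfun.sum_left blinfun.scaleR_left mult_ac)
qed

lemma rho_pairing_to_dual:
  "rho_pairing lam (\<lambda>w. to_dual \<iota> (f w)) v = rho_inner lam f (\<lambda>w. blinfun_apply \<iota> (v w))"
  by (simp add: rho_pairing_def rho_inner_def to_dual_def blinfun_inner_right.rep_eq)

lemma rho_pairing_diff_left:
  "rho_pairing lam (\<lambda>w. K w - K' w) v = rho_pairing lam K v - rho_pairing lam K' v"
  by (simp add: rho_pairing_def blinfun.diff_left right_diff_distrib sum_subtractf)

section \<open>The Gram matrix\<close>

lemma gram_quadratic_form:
  "(\<Sum>j\<in>UNIV. (\<Sum>k\<in>UNIV. a k * gram \<iota> U $ k $ j) * a j)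
    = (norm (\<Sum>k\<in>UNIV. a k *\<^sub>R blinfun_apply \<iota> (U k)))\<^sup>2"
  unfolding power2_norm_eq_inner
  by (simp add: gram_def inner_sum_left inner_sum_right sum_distrib_left sum_distrib_right mult_ac)

text \<open>Multiplying by \<open>a j\<close> and summing over \<open>j\<close> turns the hypothesis
  into a vanishing squared norm, also when the vectors \<open>U k\<close> are dependent.\<close>

lemma gram_kernel:
  assumes "\<And>j. (\<Sum>k\<in>UNIV. a k * gram \<iota> U $ k $ j) = 0"
  shows "(\<Sum>k\<in>UNIV. a k *\<^sub>R blinfun_apply \<iota> (U k)) = 0"
  using gram_quadratic_form[of a \<iota> U] assms by simp

text \<open>The statement for a single step. \<open>K\<close> is arbitrary, so explicit and implicit
  time integrations are treated alike.\<close>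

lemma dlr_step_weak_form:
  fixes \<iota> :: "'v::real_inner \<Rightarrow>\<^sub>L 'h::real_inner"
    and Y :: "'r::finite \<Rightarrow> 'w::finite \<Rightarrow> real"
  assumes lam: "discrete_prob lam"
    and state: "dlr_state Vh lam ub U Y u"
    and step: "dlr_step \<iota> Vh lam dt K f ub U Y Ut Yt ub' U' Y' u'"
    and vb: "vb \<in> Vh" and vs: "vs \<in> tangent_space Vh lam Ut Y"
  shows "rho_inner lam (\<lambda>w. blinfun_apply \<iota> ((u' w - u w) /\<^sub>R dt))
            (\<lambda>w. blinfun_apply \<iota> (vb + vs w))
          + rho_pairing lam K (\<lambda>w. vb + vs w)
        = rho_inner lam f (\<lambda>w. blinfun_apply \<iota> (vb + vs w))"
proof -
  define G where "G = (\<lambda>w. K w - to_dual \<iota> (f w))"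
  define D where "D = (\<lambda>w. blinfun_apply \<iota> ((u' w - u w) /\<^sub>R dt))"
  define Z where "Z = (\<lambda>j w. (Yt j w - Y j w) / dt)"
  define d0 where "d0 = blinfun_apply \<iota> ((ub' - ub) /\<^sub>R dt)"
  define E where "E = (\<lambda>j. blinfun_apply \<iota> ((Ut j - U j) /\<^sub>R dt))"
  define P where "P = L2_proj lam (L2_orth_compl lam (L2_span Y))"
  \<comment> \<open>The residual of the claim as a linear functional of the test function, with the
    right-hand side absorbed into \<open>G\<close>.\<close>
  define S where "S = (\<lambda>v. rho_inner lam D (\<lambda>w. blinfun_apply \<iota> (v w)) + rho_pairing lam G v)"

  have Y: "L2_orthonormal lam Y" and Y0: "\<And>j. expect lam (Y j) = 0"
    and u: "u = (\<lambda>w. ub + (\<Sum>j\<in>UNIV. Y j w *\<^sub>R U j))"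
    using state by (auto simp: dlr_state_def L2_0_def)
  have mean_eq: "\<And>x. x \<in> Vh \<Longrightarrow> d0 \<bullet> blinfun_apply \<iota> x + blinfun_apply (expect lam G) x = 0"
    and det_eq: "\<And>j x. x \<in> Vh \<Longrightarrow> E j \<bullet> blinfun_apply \<iota> x
        + blinfun_apply (expect lam (\<lambda>w. Y j w *\<^sub>R G w)) x = 0"
    and stoch: "stoch_eq \<iota> lam dt G Y Ut Yt"
    and reorth: "\<And>w. (\<Sum>j\<in>UNIV. Y' j w *\<^sub>R U' j) = (\<Sum>j\<in>UNIV. Yt j w *\<^sub>R Ut j)"
    and Y'0: "\<And>j. expect lam (Y' j) = 0"
    and u': "u' = (\<lambda>w. ub' + (\<Sum>j\<in>UNIV. Y' j w *\<^sub>R U' j))"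
    using step by (simp_all add: dlr_step_def dlr_state_def L2_0_def G_def d0_def E_def Let_def)
  have stoch': "(\<Sum>k\<in>UNIV. Z k w * gram \<iota> Ut $ k $ j)
      = - P (\<lambda>w. blinfun_apply (centred lam G w) (Ut j)) w" for j w
    using stoch unfolding stoch_eq_def Z_def P_def by (simp add: eq_neg_iff_add_eq_0)
  \<comment> \<open>The stochastic equation tested with a scalar \<open>z\<close>. Two choices
    matter below: \<open>z = Y i\<close>, where the projected term vanishes, and \<open>z\<close>
    orthogonal to all \<open>Y j\<close>, where the projection drops out.\<close>
  have Z_gram: "(\<Sum>k\<in>UNIV. L2_inner lam (Z k) z * gram \<iota> Ut $ k $ j)
      = - L2_inner lam (P (\<lambda>w. blinfun_apply (centred lam G w) (Ut j))) z" for j z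
    unfolding L2_inner_sum_left[symmetric] stoch' by (simp add: rho_inner_def sum_negf)

  \<comment> \<open>\<open>reorth\<close> replaces the new modes by \<open>Yt\<close> and
    \<open>Ut\<close>; then \<open>Yt Ut - Y U = (Yt - Y) Ut + Y (Ut - U)\<close>.\<close>
  have D_eq: "D = (\<lambda>w. d0 + (\<Sum>j\<in>UNIV. Z j w *\<^sub>R blinfun_apply \<iota> (Ut j))
      + (\<Sum>j\<in>UNIV. Y j w *\<^sub>R E j))"
    unfolding D_def u u' reorth d0_def Z_def E_def
    by (simp add: fun_eq_iff blinfun.add_right blinfun.diff_right blinfun.scaleR_right
        blinfun.sum_right scaleR_sum_right scaleR_add_right scaleR_diff_right scaleR_diff_left
        sum_subtractf sum.distrib divide_inverse mult.commute right_diff_distrib)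
  have expect_D: "expect lam (\<lambda>w. y w *\<^sub>R D w) = expect lam y *\<^sub>R d0
      + (\<Sum>j\<in>UNIV. L2_inner lam (Z j) y *\<^sub>R blinfun_apply \<iota> (Ut j))
      + (\<Sum>j\<in>UNIV. L2_inner lam (Y j) y *\<^sub>R E j)" for y
    by (simp add: D_eq scaleR_add_right scaleR_sum_right expect_add expect_sum
        expect_scaleR_const expect_mult)
  \<comment> \<open>A tensor test function reduces the residual to weighted means tested with
    \<open>x\<close>, the form of the equations of the scheme.\<close>
  have S_tensor: "S (\<lambda>w. y w *\<^sub>R x) = expect lam (\<lambda>w. y w *\<^sub>R D w) \<bullet> blinfun_apply \<iota> x
      + blinfun_apply (expect lam (\<lambda>w. y w *\<^sub>R G w)) x" for y x
    by (simp add: S_def blinfun.scaleR_right rho_inner_tensor rho_pairing_tensor)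
  have S_add: "S (\<lambda>w. v w + v' w) = S v + S v'" for v v'
    by (simp add: S_def rho_inner_def rho_pairing_def blinfun.add_right inner_add_right
        distrib_left sum.distrib)
  have S_0: "S (\<lambda>w. 0) = 0"
    by (simp add: S_def rho_inner_def rho_pairing_def)
  have S_sum: "S (\<lambda>w. \<Sum>i\<in>A. v i w) = (\<Sum>i\<in>A. S (v i))" if "finite A" for A :: "'r set" and v
    using that by (induction A rule: finite_induct) (simp_all add: S_0 S_add)

  have S_mean: "S (\<lambda>w. vb) = 0"
  proof -
    \<comment> \<open>\<open>D\<close> is split afresh with \<open>Y'\<close> instead of
      \<open>Yt\<close>: zero mean is given for \<open>Y'\<close> and \<open>Y\<close>, so only
      \<open>d0\<close> survives the expectation.\<close>
    have "D = (\<lambda>w. d0 + (\<Sum>j\<in>UNIV. Y' j w *\<^sub>R blinfun_apply \<iota> (U' j /\<^sub>R dt))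
        + (\<Sum>j\<in>UNIV. Y j w *\<^sub>R blinfun_apply \<iota> (- U j /\<^sub>R dt)))"
      unfolding D_def u u' d0_def
      by (simp add: fun_eq_iff blinfun.add_right blinfun.diff_right blinfun.minus_right
          blinfun.scaleR_right blinfun.sum_right scaleR_sum_right scaleR_add_right
          scaleR_diff_right sum_negf mult.commute)
    then have "expect lam D = d0"
      by (simp add: expect_add expect_sum expect_scaleR_const expect_const[OF lam] Y0 Y'0)
    then show ?thesis
      using S_tensor[of "\<lambda>_. 1" vb] mean_eq[OF vb] by simp
  qed

  have S_stoch: "S (\<lambda>w. y w *\<^sub>R Ut i) = 0"
    if y0: "y \<in> L2_0 lam" and yY: "\<And>j. L2_inner lam y (Y j) = 0" for y i
  proof -
    \<comment> \<open>Zero mean of \<open>y\<close> removes \<open>d0\<close>, and orthogonality to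
      \<open>Y\<close> removes the terms with \<open>E\<close>.\<close>
    have "expect lam (\<lambda>w. y w *\<^sub>R D w) \<bullet> blinfun_apply \<iota> (Ut i)
        = (\<Sum>k\<in>UNIV. L2_inner lam (Z k) y * gram \<iota> Ut $ k $ i)"
      using y0 yY by (simp add: expect_D L2_0_def rho_inner_commute[of lam "Y _"]
          inner_sum_left gram_def)
    also have "\<dots> = - blinfun_apply (expect lam (\<lambda>w. y w *\<^sub>R G w)) (Ut i)"
      unfolding Z_gram P_def L2_inner_proj[OF lam Y yY] rho_inner_centred[OF y0] ..
    finally show ?thesis
      by (simp add: S_tensor)
  qed

  have S_det: "S (\<lambda>w. Y i w *\<^sub>R x) = 0" if x: "x \<in> Vh" for i x
  proof -
    \<comment> \<open>The cross term from the change of the stochastic modes: its coefficients form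
      a kernel vector of the Gram matrix, since the projected term is orthogonal to
      \<open>Y i\<close>.\<close>
    have "(\<Sum>k\<in>UNIV. L2_inner lam (Z k) (Y i) *\<^sub>R blinfun_apply \<iota> (Ut k)) = 0"
      by (rule gram_kernel) (simp add: Z_gram P_def L2_proj_orthogonal[OF lam Y])
    moreover have "(\<Sum>j\<in>UNIV. L2_inner lam (Y j) (Y i) *\<^sub>R E j) = E i"
      using Y by (simp add: L2_orthonormal_def if_distrib[where f = "\<lambda>c. c *\<^sub>R _"] cong: if_cong)
    ultimately show ?thesis
      using det_eq[OF x, of i] by (simp add: S_tensor expect_D Y0)
  qed

  obtain dU dY where vs_eq: "vs = (\<lambda>w. \<Sum>i\<in>UNIV. dY i w *\<^sub>R Ut i + Y i w *\<^sub>R dU i)"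
    and dU: "\<And>i. dU i \<in> Vh" and dY: "\<And>i. dY i \<in> L2_0 lam"
    and dYY: "\<And>i j. L2_inner lam (dY i) (Y j) = 0"
    using vs by (auto simp: tangent_space_def)
  have "S vs = 0"
    by (simp add: vs_eq S_sum S_add S_det[OF dU] S_stoch[OF dY dYY])
  then have "S (\<lambda>w. vb + vs w) = 0"
    by (simp add: S_add S_mean)
  then show ?thesis
    by (simp add: S_def D_def G_def rho_pairing_diff_left rho_pairing_to_dual)
qed

theorem theorem4p14:
  fixes \<iota> :: "'v::{real_inner,polish_space} \<Rightarrow>\<^sub>L 'h::{real_inner,polish_space}"
    and Vh :: "'v set"
    and lam :: "'w::finite \<Rightarrow> real"
    and L :: "'w \<Rightarrow> ('v \<Rightarrow>\<^sub>L ('v \<Rightarrow>\<^sub>L real))"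
    and timeint :: "nat \<Rightarrow> (('w \<Rightarrow> 'v) \<Rightarrow> 'w \<Rightarrow> ('v \<Rightarrow>\<^sub>L real)) \<Rightarrow>
                      ('w \<Rightarrow> 'v) \<Rightarrow> ('w \<Rightarrow> 'v) \<Rightarrow> 'w \<Rightarrow> ('v \<Rightarrow>\<^sub>L real)"
    and f :: "nat \<Rightarrow> 'w \<Rightarrow> 'h"
    and T dt :: real and N n :: nat
    and ub :: "nat \<Rightarrow> 'v"
    and U Ut :: "nat \<Rightarrow> 'r::finite \<Rightarrow> 'v"
    and Y Yt :: "nat \<Rightarrow> 'r \<Rightarrow> 'w \<Rightarrow> real"
    and u :: "nat \<Rightarrow> 'w \<Rightarrow> 'v"
  assumes gelfand: "gelfand_triple \<iota>"
    and Vh: "subspace Vh" "\<exists>B. finite B \<and> span B = Vh" "dim Vh > CARD('r)"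
    and lam: "discrete_prob lam"
    and R: "CARD('r) < CARD('w)"
    and L: "bounded_coercive L"
    and T: "T > 0" and dt: "dt = T / real N"
    and init: "dlr_state Vh lam (ub 0) (U 0) (Y 0) (u 0)"
    and step: "\<And>m. m < N \<Longrightarrow>
          dlr_step \<iota> Vh lam dt (timeint m (random_op L) (u m) (u (Suc m))) (f m)
            (ub m) (U m) (Y m) (Ut (Suc m)) (Yt (Suc m))
            (ub (Suc m)) (U (Suc m)) (Y (Suc m)) (u (Suc m))"
    and n: "n < N"
  shows "\<forall>vb\<in>Vh. \<forall>vs\<in>tangent_space Vh lam (Ut (Suc n)) (Y n).
          let vh = (\<lambda>w. vb + vs w) in
            rho_inner lam (\<lambda>w. blinfun_apply \<iota> ((u (Suc n) w - u n w) /\<^sub>R dt))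
                          (\<lambda>w. blinfun_apply \<iota> (vh w))
            + rho_pairing lam (timeint n (random_op L) (u n) (u (Suc n))) vh
            = rho_inner lam (f n) (\<lambda>w. blinfun_apply \<iota> (vh w))"
proof -
  \<comment> \<open>Orthonormality and zero mean of \<open>Y n\<close> come from the initial data or
    from the reorthonormalization in the preceding step.\<close>
  have state: "dlr_state Vh lam (ub n) (U n) (Y n) (u n)"
  proof (cases n)
    case 0
    then show ?thesis using init by simp
  next
    case (Suc m)
    then show ?thesis
      using step[of m] n by (simp add: dlr_step_def Let_def)
  qed
  show ?thesis
    unfolding Let_def using dlr_step_weak_form[OF lam state step[OF n]] by blast
qed

end
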